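(* Let $q=2^k$ with $k\ge1$, let $n=4m+2$ with $m\ge0$, and let $t,s\in\mathrm{GF}(q)$. Then \[ F(n,t,s)=\begin{cases} q^{n-2}, & t=0,\\ q^{n-2}-(-1)^{mk}\chi(s/t^2)\,q^{2m}, & t\neq0.\end{cases} \]
   Context: For $\beta\in\mathrm{GF}(q^n)$, $Tr(\beta)=\sum_{i=0}^{n-1}\beta^{q^i}$ and $St(\beta)=\sum_{0\le i<j<n}\beta^{q^i}\beta^{q^j}$. $F(n,t,s)$ is the number of $\beta\in\mathrm{GF}(q^n)$ with $Tr(\beta)=t$ and $St(\beta)=s$. $\chi$ is the canonical additive character of $\mathrm{GF}(q)$: $\chi(x)=(-1)^{Tr_{q:2}(x)}$, where $Tr_{q:2}(x)=x+x^2+\cdots+x^{2^{k-1}}\in\mathrm{GF}(2)$. *)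

theory Defs
  imports
    Complex_Main
    "HOL-Library.Cardinality"
    "HOL-Algebra.Algebraic_Closure_Type"
begin

text \<open>
  The field $GF(q^n)$ is a finite field type, and $GF(q)$ is its subfield of order $q$.
  The trace, the subtrace and the absolute trace take their values in the big field type.
\<close>

definition field_trace :: "nat \<Rightarrow> nat \<Rightarrow> 'a::field \<Rightarrow> 'a" where
  "field_trace q n \<beta> = (\<Sum>i<n. \<beta> ^ (q ^ i))"

definition field_subtrace :: "nat \<Rightarrow> nat \<Rightarrow> 'a::field \<Rightarrow> 'a" where
  "field_subtrace q n \<beta> = (\<Sum>j<n. \<Sum>i<j. \<beta> ^ (q ^ i) * \<beta> ^ (q ^ j))"

definition trace_subtrace_count :: "nat \<Rightarrow> nat \<Rightarrow> 'a::{field,finite} \<Rightarrow> 'a \<Rightarrow> nat" where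
  "trace_subtrace_count q n t s =
     card {\<beta>. field_trace q n \<beta> = t \<and> field_subtrace q n \<beta> = s}"

text \<open>
  Only meant for arguments \<open>x\<close> in the subfield with $2^k$ elements, where the absolute trace
  \<open>field_trace 2 k x\<close> $= x + x^2 + \cdots + x^{2^{k-1}}$ is \<open>0\<close> or \<open>1\<close>. The conditional is the
  embedding of $GF(2) = \{0, 1\}$ into the integer exponents.
\<close>

definition canonical_char :: "nat \<Rightarrow> 'a::field \<Rightarrow> int" where
  "canonical_char k x = (- 1) ^ (if field_trace 2 k x = 0 then 0 else 1)"

end

theory Submission
  imports Defs "HOL-Number_Theory.Residues"
begin

text \<open>
  Put $r = 2m + 1$, $E = GF(q^r)$ and $\bar x = x^{q^r}$. Splitting the conjugates of $x$ into two
  halves gives $Tr(x) = Tr_{E:K}(x + \bar x)$ and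
  $St(x) = St_{E:K}(x + \bar x) + Tr_{E:K}(x \bar x)$, so for $e \in E$ and $T = x + \bar x$
  \[ St(x + e) = St(x) + Tr_{E:K}(eT) + Tr_{E:K}(e)^2 . \]
  Count the solutions fibre by fibre over $T$. If $T \notin K$, some $e \in E$ has
  $Tr_{E:K}(e) = 0$ and $Tr_{E:K}(eT) = 1$, so $St$ is equidistributed on the fibre. As $r$ is odd,
  the only $T \in K$ with $Tr_{E:K}(T) = t$ is $t$ itself. There one has to count the $c \in K$ with
  $c^2 + tc = s + St(x_0)$ for one point $x_0$ of the fibre. For $t \ne 0$ take $x_0 = ty$ with
  $y + \bar y = 1$; the absolute trace decides whether there are two solutions or none, and
  $Tr_{q:2}(St(y)) = mk + 1$ because $y \bar y = y^2 + y$ telescopes.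
\<close>

section \<open>Iterated traces in characteristic two\<close>

lemma field_trace_0 [simp]: "field_trace q 0 x = 0"
  by (simp add: field_trace_def)

lemma field_trace_Suc [simp]: "field_trace q (Suc n) x = field_trace q n x + x ^ (q ^ n)"
  by (simp add: field_trace_def)

lemma field_subtrace_0 [simp]: "field_subtrace q 0 x = 0"
  by (simp add: field_subtrace_def)

lemma field_subtrace_Suc [simp]:
  "field_subtrace q (Suc n) x = field_subtrace q n x + field_trace q n x * x ^ (q ^ n)"
  by (simp add: field_subtrace_def field_trace_def sum_distrib_right)

lemma field_trace_concat:
  "field_trace q (a + b) x = field_trace q a x + field_trace q b (x ^ (q ^ a))"
  by (induction b) (simp_all add: power_add power_mult add.assoc)

lemma field_subtrace_concat:
  "field_subtrace q (a + b) x = field_subtrace q a x + field_subtrace q b (x ^ (q ^ a))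
     + field_trace q a x * field_trace q b (x ^ (q ^ a))"
proof (induction b)
  case (Suc b)
  then show ?case
    by (simp add: field_trace_concat power_add power_mult) (simp add: algebra_simps)
qed simp

lemma power_power_fixed:
  fixes c :: "'a::monoid_mult"
  assumes "c ^ q = c"
  shows "c ^ (q ^ i) = c"
  by (induction i) (simp_all add: assms power_mult mult.commute[of q])

lemma field_trace_scale:
  assumes "c ^ q = c"
  shows "field_trace q n (c * x) = c * field_trace q n x"
  by (induction n) (simp_all add: power_mult_distrib power_power_fixed[OF assms] algebra_simps)

lemma field_subtrace_scale:
  assumes "c ^ q = c"
  shows "field_subtrace q n (c * x) = c\<^sup>2 * field_subtrace q n x"
  by (induction n)
    (simp_all add: field_trace_scale[OF assms] power_mult_distrib power_power_fixed[OF assms]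
      algebra_simps power2_eq_square)

lemma field_trace_one: "field_trace q n 1 = of_nat n"
  by (induction n) simp_all

lemma field_subtrace_one: "field_subtrace q n 1 = of_nat (n choose 2)"
  by (induction n) (simp_all add: field_trace_one numeral_2_eq_2)

context
  fixes k q :: nat
  assumes char2: "CHAR('a::field) = 2" and q: "q = 2 ^ k"
begin

lemma power_q_add: "(x + y :: 'a) ^ (q ^ i) = x ^ (q ^ i) + y ^ (q ^ i)"
  by (rule freshmans_dream'[where n = "k * i"]) (simp_all add: char2 q power_mult)

lemma field_trace_add: "field_trace q n (x + y :: 'a) = field_trace q n x + field_trace q n y"
  by (induction n) (simp_all add: power_q_add)

lemma field_trace_power: "field_trace q n (x :: 'a) ^ q = field_trace q n (x ^ q)"
  unfolding field_trace_def
  by (subst freshmans_dream_sum'[where n = k])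
    (simp_all add: char2 q mult.commute flip: power_mult)

lemma field_subtrace_power: "field_subtrace q n (x :: 'a) ^ q = field_subtrace q n (x ^ q)"
  unfolding field_subtrace_def
  by (simp add: freshmans_dream_sum'[OF _ q[folded char2]] char2 power_mult_distrib mult.commute
      flip: power_mult)

text \<open>The mixed terms pair each conjugate of \<open>x\<close> with a conjugate of
  \<open>y\<close> of different index: all products of the two traces minus the diagonal.\<close>

lemma field_subtrace_add:
  "field_subtrace q n (x + y :: 'a) = field_subtrace q n x + field_subtrace q n y
     + field_trace q n x * field_trace q n y - field_trace q n (x * y)"
  by (induction n) (simp_all add: power_q_add field_trace_add algebra_simps)

text \<open>Detach either the first or the last of \<open>n + 1\<close> conjugates. Both equal
  \<open>x\<close> by the hypothesis, so the remaining sums agree.\<close>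

lemma field_trace_closed:
  assumes "(x :: 'a) ^ (q ^ n) = x"
  shows "field_trace q n x ^ q = field_trace q n x"
proof -
  have "field_trace q (1 + n) x = field_trace q (n + 1) x"
    by (simp only: add.commute)
  then show ?thesis
    unfolding field_trace_power by (simp only: field_trace_concat assms) simp
qed

lemma field_subtrace_closed:
  assumes "(x :: 'a) ^ (q ^ n) = x"
  shows "field_subtrace q n x ^ q = field_subtrace q n x"
proof -
  have "field_subtrace q (1 + n) x = field_subtrace q (n + 1) x"
    by (simp only: add.commute)
  then show ?thesis
    using field_trace_closed[OF assms] unfolding field_trace_power field_subtrace_power
    by (simp only: field_subtrace_concat assms) (simp add: mult.commute)
qed

end

text \<open>The sum telescopes: \<open>(x\<^sup>2 + x) ^ 2 ^ j\<close> is the sum of two consecutive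
  terms \<open>x ^ 2 ^ Suc j\<close> and \<open>x ^ 2 ^ j\<close>.\<close>

lemma field_trace_artin_schreier:
  assumes char2: "CHAR('a::field) = 2"
  shows "field_trace 2 j (x\<^sup>2 + x :: 'a) = x ^ (2 ^ j) + x"
proof (induction j)
  case 0
  show ?case
    using minus_CHAR_2[OF char2, of x x] by simp
next
  case (Suc j)
  have "(x\<^sup>2 + x) ^ 2 ^ j = x ^ 2 ^ Suc j + x ^ 2 ^ j"
    using freshmans_dream'[of "2 ^ j" j "x\<^sup>2" x] by (simp add: char2 power_mult)
  moreover have "x ^ 2 ^ j + x ^ 2 ^ j = 0"
    using minus_CHAR_2[OF char2, of "x ^ 2 ^ j" "x ^ 2 ^ j"] by simp
  ultimately show ?case
    using Suc by (simp add: algebra_simps del: power_Suc)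
qed

text \<open>The exponents \<open>2 ^ (k * i + j)\<close> with \<open>i < r\<close> and
  \<open>j < k\<close> run once through all \<open>2 ^ l\<close> with
  \<open>l < k * r\<close>.\<close>

lemma field_trace_tower:
  assumes "CHAR('a::field) = 2"
  shows "field_trace 2 k (field_trace (2 ^ k) r (x :: 'a)) = field_trace 2 (k * r) x"
proof (induction r)
  case 0
  show ?case
    using field_trace_scale[of 0 2 k 0] by simp
next
  case (Suc r)
  then show ?case
    using field_trace_add[OF assms, of 2 1 k] field_trace_concat[of 2 "k * r" k x]
    by (simp add: add.commute power_mult)
qed

section \<open>Counting\<close>

lemma card_eq_fibre_card_times:
  assumes "finite A" "finite B" "f ` A \<subseteq> B"
    and "\<And>b. b \<in> B \<Longrightarrow> card {a \<in> A. f a = b} = c"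
  shows "card A = c * card B"
proof -
  have "{b \<in> B. f a = b} = {f a}" if "a \<in> A" for a
    using assms(3) that by auto
  then have "(\<Sum>a\<in>A. card {b \<in> B. f a = b}) = card A"
    by simp
  moreover have "(\<Sum>a\<in>A. card {b \<in> B. f a = b}) = c * card B"
    by (rule sum_multicount) (use assms in auto)
  ultimately show ?thesis
    by simp
qed

lemma card_translate:
  fixes d :: "'a::group_add"
  assumes "\<And>x. x + d \<in> B \<longleftrightarrow> x \<in> A"
  shows "card A = card B"
proof -
  have "bij_betw (\<lambda>x. x + d) A B"
    by (rule bij_betw_byWitness[where f' = "\<lambda>x. x - d"])
      (use assms in \<open>auto, metis diff_add_cancel\<close>)
  then show ?thesis
    by (rule bij_betw_same_card)
qed

section \<open>Finite fields as fixed points of a power map\<close>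

lemma card_power_fixed_le:
  assumes "1 < N"
  shows "card {x :: 'a::{field, finite}. x ^ N = x} \<le> N"
proof -
  let ?p = "monom 1 N - monom 1 1 :: 'a poly"
  have "coeff ?p N = 1"
    using assms by simp
  then have "?p \<noteq> 0"
    by (metis coeff_0 zero_neq_one)
  then have "card {x. poly ?p x = 0} \<le> degree ?p"
    by (rule card_poly_roots_bound)
  also have "\<dots> \<le> N"
    by (rule degree_diff_le) (use assms in \<open>simp_all add: degree_monom_eq\<close>)
  finally show ?thesis
    by (simp add: poly_monom)
qed

text \<open>Multiplication by a nonzero \<open>x\<close> permutes the nonzero elements of
  \<open>K\<close>; comparing their products gives Fermat's identity. It serves for the whole field
  and for the subfield alike.\<close>

lemma mult_closed_power_card:
  fixes K :: "'a::{field, finite} set"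
  assumes "0 \<in> K" and mult: "\<And>x y. x \<in> K \<Longrightarrow> y \<in> K \<Longrightarrow> x * y \<in> K" and "x \<in> K"
  shows "x ^ card K = x"
proof (cases "x = 0")
  case True
  then show ?thesis
    using \<open>0 \<in> K\<close> by (auto simp: power_0_left)
next
  case False
  have "(\<lambda>y. x * y) ` (K - {0}) = K - {0}"
    by (rule card_subset_eq)
      (use mult \<open>x \<in> K\<close> False in \<open>auto simp: card_image inj_on_def\<close>)
  then have "bij_betw (\<lambda>y. x * y) (K - {0}) (K - {0})"
    using False by (simp add: bij_betw_def inj_on_def)
  then have "(\<Prod>y\<in>K - {0}. x * y) = \<Prod>(K - {0})"
    by (rule prod.reindex_bij_betw)
  then have "x ^ card (K - {0}) * \<Prod>(K - {0}) = \<Prod>(K - {0})"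
    by (simp add: prod.distrib)
  then have "x ^ card (K - {0}) = 1"
    by simp
  moreover have "card K = Suc (card (K - {0}))"
    by (rule card.remove) (use \<open>0 \<in> K\<close> in auto)
  ultimately show ?thesis
    by simp
qed

lemma power_card_field: "(x :: 'a::{field, finite}) ^ CARD('a) = x"
  by (rule mult_closed_power_card) auto

text \<open>The elements of \<open>K\<close> are roots of \<open>x ^ card K - x\<close>, which has
  at most \<open>card K\<close> roots. From here on, membership in a subfield is an
  equation.\<close>

lemma subfield_eq_power_fixed:
  fixes K :: "'a::{field, finite} set"
  assumes "subfield K (ring_of_type_algebra :: 'a ring)"
  shows "K = {x. x ^ card K = x}"
proof -
  have K: "subring K (ring_of_type_algebra :: 'a ring)"
    using subfieldE(1)[OF assms] .
  have "0 \<in> K" "1 \<in> K"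
    using subringE(2,3)[OF K] by (simp_all add: ring_of_type_algebra_def)
  have "x * y \<in> K" if "x \<in> K" "y \<in> K" for x y
    using subringE(6)[OF K that] by (simp add: ring_of_type_algebra_def)
  then have "K \<subseteq> {x. x ^ card K = x}"
    using mult_closed_power_card[OF \<open>0 \<in> K\<close>] by blast
  moreover have "card {0, 1 :: 'a} \<le> card K"
    by (rule card_mono) (use \<open>0 \<in> K\<close> \<open>1 \<in> K\<close> in auto)
  then have "card {x :: 'a. x ^ card K = x} \<le> card K"
    by (intro card_power_fixed_le) simp
  ultimately show ?thesis
    by (intro card_seteq) auto
qed

section \<open>The quadratic extension of odd relative degree\<close>

locale quadratic_tower =
  fixes K E :: "'a::{field, finite} set" and k q r :: nat
  assumes char2: "CHAR('a) = 2"
    and k_pos: "0 < k"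
    and q: "q = 2 ^ k"
    and odd_r: "odd r"
    and card_UNIV: "CARD('a) = q ^ (r + r)"
    and K: "K = {x. x ^ q = x}"
    and card_K: "card K = q"
    and E: "E = {x. x ^ (q ^ r) = x}"
begin

abbreviation Tr :: "'a \<Rightarrow> 'a" where "Tr \<equiv> field_trace q r"
abbreviation cnj :: "'a \<Rightarrow> 'a" where "cnj x \<equiv> x ^ (q ^ r)"
abbreviation rel_trace :: "'a \<Rightarrow> 'a" where "rel_trace x \<equiv> x + cnj x"
abbreviation St :: "'a \<Rightarrow> 'a" where "St \<equiv> field_subtrace q (r + r)"

lemma add_self [simp]: "(x :: 'a) + x = 0"
  using minus_CHAR_2[OF char2, of x x] by simp

lemma add_self_left [simp]: "(x :: 'a) + (x + y) = y"
  by (simp flip: add.assoc)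

lemma add_eq_iff: "(x :: 'a) + y = z \<longleftrightarrow> x = z + y"
  by (metis add.assoc add.right_neutral add_self)

lemma q_gt_1: "1 < q"
  unfolding q by (rule one_less_power) (use k_pos in auto)

lemmas cnj_add = power_q_add[OF char2 q, of _ _ r]
lemmas frob_add = power_q_add[OF char2 q, of _ _ 1, simplified]

lemma cnj_cnj: "cnj (cnj x) = x"
  using power_card_field[of x] by (simp add: card_UNIV power_add power_mult)

lemma K_subset_E: "K \<subseteq> E"
  using power_power_fixed by (auto simp: K E)

lemma E_add: "x \<in> E \<Longrightarrow> y \<in> E \<Longrightarrow> x + y \<in> E"
  by (simp add: E cnj_add)

lemma E_mult: "x \<in> E \<Longrightarrow> y \<in> E \<Longrightarrow> x * y \<in> E"
  by (simp add: E power_mult_distrib)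

lemma E_frob: "x \<in> E \<Longrightarrow> x ^ q \<in> E"
  by (simp add: E) (metis mult.commute power_mult)

lemma K_add: "x \<in> K \<Longrightarrow> y \<in> K \<Longrightarrow> x + y \<in> K"
  by (simp add: K frob_add)

lemma K_mult: "x \<in> K \<Longrightarrow> y \<in> K \<Longrightarrow> x * y \<in> K"
  by (simp add: K power_mult_distrib)

section \<open>The relative trace onto \<open>E\<close>\<close>

lemma rel_trace_in_E: "rel_trace x \<in> E"
  by (simp add: E cnj_add cnj_cnj add.commute)

lemma rel_trace_translate: "e \<in> E \<Longrightarrow> rel_trace (x + e) = rel_trace x"
  by (simp add: E cnj_add algebra_simps)

lemma rel_trace_eq_0_iff: "rel_trace x = 0 \<longleftrightarrow> x \<in> E"
  by (auto simp: E add_eq_iff)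

lemma rel_trace_add_eq_iff: "rel_trace (e + x) = rel_trace x \<longleftrightarrow> e \<in> E"
proof -
  have "rel_trace (e + x) = rel_trace e + rel_trace x"
    by (simp add: cnj_add add_ac)
  then show ?thesis
    using rel_trace_eq_0_iff[of e] by simp
qed

lemma card_fibre_eq_card_E:
  assumes "rel_trace x0 = T"
  shows "card {x. rel_trace x = T} = card E"
  using assms rel_trace_add_eq_iff by (intro card_translate[of x0, symmetric]) auto

lemma CARD_eq: "CARD('a) = card E * card (range rel_trace)"
  by (rule card_eq_fibre_card_times[where f = rel_trace]) (auto intro: card_fibre_eq_card_E)

lemma r_pos: "0 < r"
  using odd_r by (rule odd_pos)

text \<open>Root counting bounds \<open>E\<close> from above. From below, the fibres of
  \<open>rel_trace\<close> are cosets of \<open>E\<close> and its image lies in \<open>E\<close>, so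
  the field has at most \<open>(card E)\<^sup>2\<close> elements.\<close>

lemma card_E: "card E = q ^ r"
proof (rule antisym)
  show "card E \<le> q ^ r"
    unfolding E by (intro card_power_fixed_le one_less_power q_gt_1 r_pos)
  have "card (range rel_trace) \<le> card E"
    by (rule card_mono) (use rel_trace_in_E in auto)
  then have "(q ^ r)\<^sup>2 \<le> (card E)\<^sup>2"
    using CARD_eq by (simp add: card_UNIV power_add power2_eq_square)
  then show "q ^ r \<le> card E"
    by (simp add: power2_nat_le_eq_le)
qed

lemma range_rel_trace: "range rel_trace = E"
proof (rule card_subset_eq)
  show "card (range rel_trace) = card E"
    using CARD_eq q_gt_1 by (simp add: card_UNIV card_E power_add)
qed (use rel_trace_in_E in auto)

lemma obtain_rel_trace:
  assumes "T \<in> E"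
  obtains x where "rel_trace x = T"
proof -
  have "T \<in> range rel_trace"
    using assms unfolding range_rel_trace .
  then show thesis
    using that by (elim rangeE) (rule that, rule sym)
qed

section \<open>The trace from \<open>E\<close> to \<open>K\<close>\<close>

lemma Tr_add: "Tr (x + y) = Tr x + Tr y"
  by (rule field_trace_add[OF char2 q])

lemma Tr_mult: "c \<in> K \<Longrightarrow> Tr (c * x) = c * Tr x"
  by (rule field_trace_scale) (simp add: K)

lemma Tr_in_K: "x \<in> E \<Longrightarrow> Tr x \<in> K"
  using field_trace_closed[OF char2 q] by (simp add: K E)

lemma of_nat_eq_if_even: "(of_nat j :: 'a) = (if even j then 0 else 1)"
  by (induction j) auto

text \<open>Here the oddness of \<open>r\<close> enters; it makes \<open>Tr\<close> the identity on
  \<open>K\<close>.\<close>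

lemma Tr_one: "Tr 1 = 1"
  using odd_r by (simp add: field_trace_one of_nat_eq_if_even)

lemma Tr_K: "c \<in> K \<Longrightarrow> Tr c = c"
  using Tr_mult[of c 1] by (simp add: Tr_one)

lemma Tr_frob: "x \<in> E \<Longrightarrow> Tr (x ^ q) = Tr x"
  using field_trace_closed[OF char2 q, of x r]
  by (simp add: E flip: field_trace_power[OF char2 q])

lemma Tr_square: "Tr (x\<^sup>2) = (Tr x)\<^sup>2"
  unfolding field_trace_def
  by (simp add: freshmans_dream_sum[OF _ char2[symmetric]] char2 mult.commute flip: power_mult)

text \<open>Translation by \<open>b\<close> in \<open>K\<close> changes \<open>Tr\<close> by
  \<open>b\<close>, so all \<open>q\<close> fibres of \<open>Tr\<close> on \<open>E\<close> have
  equal size.\<close>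

lemma card_Tr_fibre:
  assumes "c \<in> K"
  shows "card {e \<in> E. Tr e = c} = q ^ (r - 1)"
proof -
  have eq: "card {e \<in> E. Tr e = b} = card {e \<in> E. Tr e = 0}" if "b \<in> K" for b
  proof (rule card_translate[of b])
    fix x
    have "x + b \<in> E \<longleftrightarrow> x \<in> E"
      using E_add[of "x + b" b] E_add[of x b] that K_subset_E by (auto simp: add.assoc)
    then show "x + b \<in> {e \<in> E. Tr e = 0} \<longleftrightarrow> x \<in> {e \<in> E. Tr e = b}"
      by (simp add: Tr_add Tr_K that add_eq_iff)
  qed
  have "card E = card {e \<in> E. Tr e = 0} * card K"
    by (rule card_eq_fibre_card_times[where f = Tr]) (auto simp: Tr_in_K eq)
  moreover have "q ^ r = q ^ (r - 1) * q"
    using r_pos by (simp flip: power_Suc2)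
  ultimately have "card {e \<in> E. Tr e = 0} = q ^ (r - 1)"
    using q_gt_1 by (simp add: card_E card_K)
  with eq[OF assms] show ?thesis
    by simp
qed

section \<open>Trace and subtrace in terms of the relative trace\<close>

lemma trace_eq: "field_trace q (r + r) x = Tr (rel_trace x)"
  by (simp add: field_trace_concat Tr_add)

lemma St_eq: "St x = field_subtrace q r (rel_trace x) + Tr (x * cnj x)"
  by (simp add: field_subtrace_concat field_subtrace_add[OF char2 q])

lemma St_in_K: "St x \<in> K"
  using field_subtrace_closed[OF char2 q, of x "r + r"] cnj_cnj[of x]
  by (simp add: K power_add power_mult)

text \<open>Adding \<open>e\<close> keeps the relative trace and changes \<open>x * cnj x\<close> by
  \<open>e * rel_trace x + e\<^sup>2\<close>, while \<open>Tr\<close> commutes with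
  squaring.\<close>

lemma St_translate:
  assumes "e \<in> E"
  shows "St (x + e) = St x + (Tr (e * rel_trace x) + (Tr e)\<^sup>2)"
proof -
  have "cnj e = e"
    using assms by (simp add: E)
  then have "(x + e) * cnj (x + e) = x * cnj x + (e * rel_trace x + e\<^sup>2)"
    by (simp add: cnj_add algebra_simps power2_eq_square)
  then show ?thesis
    using St_eq[of "x + e"] unfolding rel_trace_translate[OF assms]
    by (simp only: St_eq Tr_add Tr_square add.assoc)
qed

section \<open>Counting fibre by fibre\<close>

lemma card_fibre_not_in_K:
  assumes "T \<in> E" "T \<notin> K" "s \<in> K"
  shows "card {x. rel_trace x = T \<and> St x = s} = q ^ (r - 1)"
proof -
  \<comment> \<open>Additive Hilbert 90: $d + d^q$ has trace zero, and multiplication by $T$ turns its trace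
    into that of $d^q (T + T^q)$; so choose $d$ with $d^q = u = 1 / (T + T^q)$.\<close>
  define u where "u = 1 / (T + T ^ q)"
  define d where "d = u ^ (q ^ (r - 1))"
  have "T + T ^ q \<noteq> 0"
    using assms(2) by (auto simp: add_eq_iff K)
  then have u: "u * (T + T ^ q) = 1"
    by (simp add: u_def)
  have "u \<in> E"
    using E_add[OF assms(1) E_frob[OF assms(1)]] by (simp add: u_def E power_divide)
  \<comment> \<open>On \<open>E\<close> the power \<open>q ^ (r - 1)\<close> inverts the Frobenius
    map, so \<open>d\<close> is the \<open>q\<close>-th root of \<open>u\<close>.\<close>
  have "d ^ q = cnj u"
    using r_pos by (cases r) (simp_all add: d_def mult.commute flip: power_mult)
  then have "d ^ q = u"
    using \<open>u \<in> E\<close> by (simp add: E)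
  have "d \<in> E"
    using \<open>u \<in> E\<close> by (simp add: E d_def mult.commute flip: power_mult) (simp add: power_mult)
  define e where "e = d + u"
  have "e \<in> E"
    by (simp add: e_def E_add \<open>d \<in> E\<close> \<open>u \<in> E\<close>)
  have "Tr e = 0"
    using Tr_frob[OF \<open>d \<in> E\<close>] by (simp add: e_def Tr_add \<open>d ^ q = u\<close>)
  have "Tr (d * T) = Tr (u * T ^ q)"
    using Tr_frob[OF E_mult[OF \<open>d \<in> E\<close> assms(1)]] by (simp add: power_mult_distrib \<open>d ^ q = u\<close>)
  then have "Tr (e * T) = Tr (u * (T + T ^ q))"
    by (simp add: e_def Tr_add distrib_left distrib_right add.commute)
  then have "Tr (e * T) = 1"
    by (simp add: u Tr_one)

  let ?F = "\<lambda>b. {x. rel_trace x = T \<and> St x = b}"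
  \<comment> \<open>By \<open>K\<close>-linearity \<open>b * e\<close> still has trace zero, so
    adding it changes \<open>St\<close> by exactly \<open>b\<close>.\<close>
  have shift: "card (?F b) = card (?F 0)" if "b \<in> K" for b
  proof (rule card_translate[of "b * e"])
    fix x
    have be: "b * e \<in> E"
      using that K_subset_E \<open>e \<in> E\<close> by (auto intro: E_mult)
    have "Tr (b * e * T) = b" "Tr (b * e) = 0"
      using Tr_mult[OF that, of "e * T"] Tr_mult[OF that, of e]
      by (simp_all add: \<open>Tr (e * T) = 1\<close> \<open>Tr e = 0\<close> mult.assoc)
    then have "St x + (Tr (b * e * T) + (Tr (b * e))\<^sup>2) = 0 \<longleftrightarrow> St x = b"
      by (simp add: add_eq_iff)
    then show "x + b * e \<in> ?F 0 \<longleftrightarrow> x \<in> ?F b"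
      unfolding mem_Collect_eq rel_trace_translate[OF be] St_translate[OF be]
      by (intro conj_cong refl) simp
  qed
  obtain x0 where "rel_trace x0 = T"
    by (rule obtain_rel_trace[OF assms(1)])
  then have "q ^ r = card {x. rel_trace x = T}"
    by (simp add: card_fibre_eq_card_E card_E)
  also have "\<dots> = card (?F 0) * card K"
    by (rule card_eq_fibre_card_times[where f = St]) (auto simp: St_in_K shift)
  finally have "q ^ r = card (?F 0) * q"
    by (simp add: card_K)
  moreover have "q ^ r = q ^ (r - 1) * q"
    using r_pos by (simp flip: power_Suc2)
  ultimately have "card (?F 0) = q ^ (r - 1)"
    using q_gt_1 by simp
  then show ?thesis
    unfolding shift[OF assms(3)] .
qed

text \<open>For \<open>t\<close> in \<open>K\<close>, translating \<open>x0\<close> by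
  \<open>e\<close> changes \<open>St\<close> by an amount depending only on \<open>c = Tr e\<close>,
  and each \<open>c\<close> comes from \<open>q ^ (r - 1)\<close> elements \<open>e\<close>.\<close>

lemma card_fibre_in_K:
  assumes "t \<in> K" "rel_trace x0 = t"
  shows "card {x. rel_trace x = t \<and> St x = s} = q ^ (r - 1) * card {c \<in> K. c\<^sup>2 + t * c = s + St x0}"
proof -
  let ?B = "{c \<in> K. c\<^sup>2 + t * c = s + St x0}"
  let ?A = "{e \<in> E. (Tr e)\<^sup>2 + t * Tr e = s + St x0}"
  have "card ?A = card {x. rel_trace x = t \<and> St x = s}"
  proof (rule card_translate[of x0])
    fix e
    have tr: "rel_trace (e + x0) = t \<longleftrightarrow> e \<in> E"
      using rel_trace_add_eq_iff[of e x0] assms(2) by metis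
    have "St (e + x0) = s \<longleftrightarrow> (Tr e)\<^sup>2 + t * Tr e = s + St x0" if "e \<in> E"
      using St_translate[OF that, of x0] assms(2) Tr_mult[OF assms(1), of e]
      by (simp add: add.commute mult.commute) (metis add.commute add_eq_iff)
    with tr show "e + x0 \<in> {x. rel_trace x = t \<and> St x = s} \<longleftrightarrow> e \<in> ?A"
      by blast
  qed
  moreover have "card ?A = q ^ (r - 1) * card ?B"
  proof (rule card_eq_fibre_card_times[where f = Tr])
    fix c assume "c \<in> ?B"
    then have "{e \<in> ?A. Tr e = c} = {e \<in> E. Tr e = c}"
      by auto
    then show "card {e \<in> ?A. Tr e = c} = q ^ (r - 1)"
      using card_Tr_fibre \<open>c \<in> ?B\<close> by simp
  qed (auto simp: Tr_in_K)
  ultimately show ?thesis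
    by simp
qed

text \<open>Of the \<open>q ^ (r - 1)\<close> relative traces \<open>T\<close> with
  \<open>Tr T = t\<close>, only \<open>T = t\<close> lies in \<open>K\<close>; the others contribute
  equally.\<close>

lemma count_eq:
  assumes "t \<in> K" "s \<in> K" "rel_trace x0 = t"
  shows "trace_subtrace_count q (r + r) t s =
    q ^ (r - 1) * (q ^ (r - 1) - 1 + card {c \<in> K. c\<^sup>2 + t * c = s + St x0})"
proof -
  let ?B = "{T \<in> E. Tr T = t} - {t}"
  let ?A = "{x. rel_trace x \<in> ?B \<and> St x = s}"
  have tE: "t \<in> E" and Tr_t: "Tr t = t"
    using assms(1) K_subset_E by (auto simp: Tr_K)
  have "card ?A = q ^ (r - 1) * card ?B"
  proof (rule card_eq_fibre_card_times[where f = rel_trace])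
    fix T assume T: "T \<in> ?B"
    then have "T \<notin> K"
      using Tr_K by auto
    then have "card {x. rel_trace x = T \<and> St x = s} = q ^ (r - 1)"
      using T assms(2) by (intro card_fibre_not_in_K) auto
    moreover have "{x \<in> ?A. rel_trace x = T} = {x. rel_trace x = T \<and> St x = s}"
      using T by auto
    ultimately show "card {x \<in> ?A. rel_trace x = T} = q ^ (r - 1)"
      by simp
  qed auto
  moreover have "card ?B = q ^ (r - 1) - 1"
    using card_Tr_fibre[OF assms(1)] tE Tr_t by (subst card_Diff_singleton) auto
  moreover have "{x. field_trace q (r + r) x = t \<and> St x = s}
      = {x. rel_trace x = t \<and> St x = s} \<union> ?A"
    using rel_trace_in_E Tr_t by (auto simp: trace_eq)
  moreover have "card ({x. rel_trace x = t \<and> St x = s} \<union> ?A)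
      = card {x. rel_trace x = t \<and> St x = s} + card ?A"
    by (rule card_Un_disjoint) auto
  ultimately show ?thesis
    unfolding trace_subtrace_count_def card_fibre_in_K[OF assms(1,3)]
    by (simp add: distrib_left)
qed

section \<open>The absolute trace and quadratic equations over \<open>K\<close>\<close>

lemma zero_in_K: "0 \<in> K" and one_in_K: "1 \<in> K"
  using q_gt_1 by (simp_all add: K)

lemma abs_trace_add: "field_trace 2 k (x + y :: 'a) = field_trace 2 k x + field_trace 2 k y"
  by (rule field_trace_add[where k = 1]) (simp_all add: char2)

lemma abs_trace_cases:
  assumes "x \<in> K"
  shows "field_trace 2 k x = 0 \<or> field_trace 2 k x = 1"
proof -
  have "(field_trace 2 k x)\<^sup>2 = field_trace 2 k x"
    using assms field_trace_closed[OF char2, of 2 1 x k] by (simp add: K q)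
  then show ?thesis
    by (simp add: power2_eq_square)
qed

lemma abs_trace_Tr: "field_trace 2 k (Tr x) = field_trace 2 (k * r) x"
  unfolding q by (rule field_trace_tower[OF char2])

text \<open>Besides evaluating \<open>St y\<close>, this supplies an element of \<open>K\<close>
  with absolute trace one.\<close>

lemma abs_trace_Tr_norm:
  assumes "rel_trace y = 1"
  shows "field_trace 2 k (Tr (y * cnj y)) = 1"
proof -
  have cnj_y: "cnj y = y + 1"
    using add_self_left[of y "cnj y"] unfolding assms by (rule sym)
  then have "y * cnj y = y\<^sup>2 + y"
    by (simp only: power2_eq_square distrib_left mult_1_right)
  then have "field_trace 2 k (Tr (y * cnj y)) = y ^ (2 ^ (k * r)) + y"
    by (simp only: abs_trace_Tr field_trace_artin_schreier[OF char2])
  also have "y ^ (2 ^ (k * r)) = y + 1"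
    unfolding power_mult q[symmetric] cnj_y ..
  finally show ?thesis
    by (simp only: add.assoc add.commute[of 1] add_self_left)
qed

lemma abs_trace_St:
  assumes "rel_trace y = 1"
  shows "field_trace 2 k (St y) = of_nat (k * (r choose 2)) + 1"
proof -
  \<comment> \<open>Elements of the prime field are fixed by squaring and factor out of the absolute
    trace, leaving the trace of \<open>1\<close>, which is \<open>k\<close>.\<close>
  have "field_trace 2 k (of_nat j :: 'a) = of_nat (k * j)" for j
    using field_trace_scale[of "of_nat j :: 'a" 2 k 1]
    by (simp add: field_trace_one of_nat_eq_if_even split: if_splits)
  then show ?thesis
    using abs_trace_Tr_norm[OF assms] by (simp add: St_eq assms abs_trace_add field_subtrace_one)
qed

text \<open>The map \<open>c\<^sup>2 + c\<close> is two-to-one on \<open>K\<close>, and its image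
  lies in the kernel of the absolute trace. Both have half the elements of \<open>K\<close>, so they
  coincide.\<close>

lemma card_artin_schreier:
  assumes "u \<in> K"
  shows "card {c \<in> K. c\<^sup>2 + c = u} = (if field_trace 2 k u = 0 then 2 else 0)"
proof -
  let ?P = "\<lambda>c :: 'a. c\<^sup>2 + c"
  let ?Z = "{u \<in> K. field_trace 2 k u = 0}"
  have "card {c \<in> K. ?P c = v} = 2" if v: "v \<in> ?P ` K" for v
  proof -
    from v obtain d where d: "d \<in> K" "v = ?P d"
      by auto
    have "?P c = ?P d \<longleftrightarrow> c = d \<or> c = d + 1" for c
    proof -
      have "?P c + ?P d = (c + d) * (c + (d + 1))"
        by (simp add: power2_eq_square algebra_simps)
      then show ?thesis
        using add_eq_iff[of "?P c" "?P d" 0] add_eq_iff[of c d 0] add_eq_iff[of c "d + 1" 0]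
        by (simp only: add_0 mult_eq_0_iff)
    qed
    then have "{c \<in> K. ?P c = v} = {d, d + 1}"
      using d K_add[OF d(1) one_in_K] by auto
    then show ?thesis
      by simp
  qed
  then have "card K = 2 * card (?P ` K)"
    by (intro card_eq_fibre_card_times[where f = ?P]) auto
  moreover have "card K = card ?Z * card {0, 1 :: 'a}"
  proof (rule card_eq_fibre_card_times[where f = "field_trace 2 k"])
    obtain y where y: "rel_trace y = 1"
      by (rule obtain_rel_trace[OF subsetD[OF K_subset_E one_in_K]])
    define w where "w = Tr (y * cnj y)"
    have "w \<in> K"
      unfolding w_def by (rule Tr_in_K) (simp add: E power_mult_distrib cnj_cnj mult.commute)
    \<comment> \<open>Adding \<open>w\<close>, of absolute trace one, swaps the two fibres.\<close>
    have "card {a \<in> K. field_trace 2 k a = 1} = card ?Z"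
    proof (rule card_translate[of w])
      fix x
      have "x + w \<in> K \<longleftrightarrow> x \<in> K"
        using K_add[of "x + w" w] K_add[of x w] \<open>w \<in> K\<close> by (auto simp: add.assoc)
      then show "x + w \<in> ?Z \<longleftrightarrow> x \<in> {a \<in> K. field_trace 2 k a = 1}"
        using abs_trace_Tr_norm[OF y] by (simp add: w_def abs_trace_add add_eq_iff)
    qed
    then show "card {a \<in> K. field_trace 2 k a = b} = card ?Z" if "b \<in> {0, 1}" for b
      using that by auto
  qed (use abs_trace_cases in auto)
  moreover have "?P ` K \<subseteq> ?Z"
  proof (rule image_subsetI)
    fix c assume "c \<in> K"
    \<comment> \<open>The telescoped trace is \<open>c ^ q + c\<close>, which vanishes on
      \<open>K\<close>.\<close>
    then have "field_trace 2 k (?P c) = 0"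
      unfolding field_trace_artin_schreier[OF char2] by (simp add: K q)
    with \<open>c \<in> K\<close> show "?P c \<in> ?Z"
      by (simp add: K_add K_mult power2_eq_square)
  qed
  ultimately have "?P ` K = ?Z"
    by (intro card_subset_eq) auto
  then have "u \<in> ?P ` K \<longleftrightarrow> field_trace 2 k u = 0"
    using assms by simp
  then show ?thesis
    using \<open>\<And>v. v \<in> ?P ` K \<Longrightarrow> card {c \<in> K. ?P c = v} = 2\<close>[of u]
    by (auto simp: card_eq_0_iff)
qed

text \<open>Squaring is additive in characteristic two, hence injective, and so bijective on the
  finite set \<open>K\<close>.\<close>

lemma card_square_root:
  assumes "u \<in> K"
  shows "card {c \<in> K. c\<^sup>2 = u} = 1"
proof -
  have "inj_on (\<lambda>c. c\<^sup>2) K"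
  proof (rule inj_onI)
    fix c d :: 'a
    assume "c\<^sup>2 = d\<^sup>2"
    moreover have "(c + d)\<^sup>2 = c\<^sup>2 + d\<^sup>2"
      by (simp add: power2_eq_square algebra_simps)
    ultimately have "c + d = 0"
      by simp
    then show "c = d"
      by (simp add: add_eq_iff)
  qed
  moreover from this have "(\<lambda>c. c\<^sup>2) ` K = K"
    by (intro endo_inj_surj) (auto simp: K_mult power2_eq_square)
  ultimately have "card {c \<in> K. c\<^sup>2 = u} \<le> 1" "u \<in> (\<lambda>c. c\<^sup>2) ` K"
    using assms by (auto simp: inj_on_def card_le_Suc0_iff_eq)
  then have "card {c \<in> K. c\<^sup>2 = u} \<le> 1" "{c \<in> K. c\<^sup>2 = u} \<noteq> {}"
    by auto
  then show ?thesis
    by (simp add: le_antisym Suc_leI card_gt_0_iff)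
qed

section \<open>The two cases of the count\<close>

lemma count_trace_0:
  assumes "s \<in> K"
  shows "trace_subtrace_count q (r + r) 0 s = (q ^ (r - 1))\<^sup>2"
proof -
  \<comment> \<open>With base point \<open>0\<close> the quadratic becomes
    \<open>c\<^sup>2 = s\<close>; its single solution makes up for the \<open>- 1\<close> in
    \<open>count_eq\<close>.\<close>
  have "rel_trace 0 = 0" "St 0 = 0"
    using rel_trace_eq_0_iff[of 0] field_subtrace_scale[of 0 q "r + r" 0] q_gt_1
    by (auto simp: E)
  moreover have "0 < q ^ (r - 1)"
    using q_gt_1 by simp
  ultimately show ?thesis
    using count_eq[OF zero_in_K assms, of 0] card_square_root[OF assms]
    by (simp add: power2_eq_square)
qed

lemma count_trace_nonzero:
  assumes "t \<in> K" "s \<in> K" "t \<noteq> 0"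
  shows "trace_subtrace_count q (r + r) t s = q ^ (r - 1) * (q ^ (r - 1) - 1 +
    (if field_trace 2 k (s / t\<^sup>2) = of_nat (k * (r choose 2)) + 1 then 2 else 0))"
proof -
  obtain y where y: "rel_trace y = 1"
    by (rule obtain_rel_trace[OF subsetD[OF K_subset_E one_in_K]])
  have "cnj t = t"
    using assms(1) K_subset_E by (auto simp: E)
  then have ty: "rel_trace (t * y) = t"
    using y by (simp add: power_mult_distrib flip: distrib_left)
  have St_ty: "St (t * y) = t\<^sup>2 * St y"
    by (rule field_subtrace_scale) (use assms(1) in \<open>simp add: K\<close>)
  have tK: "t * c \<in> K \<longleftrightarrow> c \<in> K" for c
    using assms(1,3) by (simp add: K power_mult_distrib)
  let ?u = "s / t\<^sup>2 + St y"
  have "?u \<in> K"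
    using assms(1,2) St_in_K by (intro K_add) (simp_all add: K power_divide power_mult_distrib power2_eq_square)
  \<comment> \<open>With base point \<open>t * y\<close>, substituting \<open>t * c\<close> and
    dividing by \<open>t\<^sup>2\<close> gives an Artin-Schreier equation.\<close>
  have "bij_betw (\<lambda>c. t * c) {c \<in> K. c\<^sup>2 + c = ?u} {c \<in> K. c\<^sup>2 + t * c = s + St (t * y)}"
  proof (rule bij_betw_byWitness[where f' = "\<lambda>c. c / t"])
    have "(t * c)\<^sup>2 + t * (t * c) = s + St (t * y) \<longleftrightarrow> c\<^sup>2 + c = ?u" for c
    proof -
      have "(t * c)\<^sup>2 + t * (t * c) = t\<^sup>2 * (c\<^sup>2 + c)" "s + St (t * y) = t\<^sup>2 * ?u"
        using assms(3) by (simp_all add: St_ty field_simps power2_eq_square)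
      then show ?thesis
        using assms(3) by simp
    qed
    note eq = this
    show "(\<lambda>c. t * c) ` {c \<in> K. c\<^sup>2 + c = ?u} \<subseteq> {c \<in> K. c\<^sup>2 + t * c = s + St (t * y)}"
      using eq tK by blast
    show "(\<lambda>c. c / t) ` {c \<in> K. c\<^sup>2 + t * c = s + St (t * y)} \<subseteq> {c \<in> K. c\<^sup>2 + c = ?u}"
    proof
      fix d assume "d \<in> (\<lambda>c. c / t) ` {c \<in> K. c\<^sup>2 + t * c = s + St (t * y)}"
      then obtain c where "d = c / t" "c \<in> K" "c\<^sup>2 + t * c = s + St (t * y)"
        by blast
      then show "d \<in> {c \<in> K. c\<^sup>2 + c = ?u}"
        using eq[of d] tK[of d] assms(3) by simp
    qed
  qed (use assms(3) in auto)
  then have "card {c \<in> K. c\<^sup>2 + t * c = s + St (t * y)} = card {c \<in> K. c\<^sup>2 + c = ?u}"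
    by (simp add: bij_betw_same_card)
  also have "\<dots> = (if field_trace 2 k ?u = 0 then 2 else 0)"
    by (rule card_artin_schreier) fact
  also have "field_trace 2 k ?u = 0 \<longleftrightarrow>
      field_trace 2 k (s / t\<^sup>2) = of_nat (k * (r choose 2)) + 1"
    by (simp only: abs_trace_add abs_trace_St[OF y] add_eq_iff add_0)
  finally show ?thesis
    using count_eq[OF assms(1,2) ty] by simp
qed

end

theorem theorem3:
  fixes K :: "'a::{field,finite} set"
    and q k n m :: nat
    and t s :: 'a
  assumes "k \<ge> 1" and "q = 2 ^ k" and "n = 4 * m + 2"
    and "CARD('a) = q ^ n"
    and "subfield K (ring_of_type_algebra :: 'a ring)" and "card K = q"
    and "t \<in> K" and "s \<in> K"
  shows "int (trace_subtrace_count q n t s) =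
    (if t = 0 then int q ^ (n - 2)
     else int q ^ (n - 2) - (- 1) ^ (m * k) * canonical_char k (s / t\<^sup>2) * int q ^ (2 * m))"
proof -
  define r where "r = 2 * m + 1"
  have n: "n = r + r" "r - 1 = 2 * m" "r + r - 2 = 2 * m + 2 * m"
    by (simp_all add: r_def assms(3))
  \<comment> \<open>The characteristic is a prime dividing the order of the field, a power of
    two.\<close>
  have "CHAR('a) dvd 2 ^ (k * n)"
    using CHAR_dvd_CARD[where ?'a = 'a] by (simp add: assms(2,4) power_mult)
  moreover have "prime CHAR('a)"
    using prime_CHAR_semidom[where ?'a = 'a] finite_imp_CHAR_pos[where ?'a = 'a] by simp
  ultimately have "CHAR('a) = 2"
    using prime_dvd_power primes_dvd_imp_eq two_is_prime_nat by blast
  then interpret quadratic_tower K "{x. x ^ (q ^ r) = x}" k q r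
    using assms subfield_eq_power_fixed[OF assms(5)]
    by unfold_locales (simp_all add: r_def)
  show ?thesis
  proof (cases "t = 0")
    case True
    then show ?thesis
      using count_trace_0[OF assms(8)] unfolding n
      by (simp only: True power_add power2_eq_square of_nat_mult of_nat_power if_True)
  next
    case False
    have "s / t\<^sup>2 \<in> K"
      using assms(7,8) by (simp add: K power_divide power_mult_distrib power2_eq_square)
    then have "field_trace 2 k (s / t\<^sup>2) = 0 \<or> field_trace 2 k (s / t\<^sup>2) = 1"
      by (rule abs_trace_cases)
    moreover have "r choose 2 = r * m"
      by (simp add: choose_two r_def)
    \<comment> \<open>As \<open>r\<close> is odd, \<open>r * m\<close> has the parity of
      \<open>m\<close>; this is the source of the sign \<open>(- 1) ^ (m * k)\<close>.\<close>
    then have "even (k * (r choose 2)) \<longleftrightarrow> even (m * k)"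
      by (auto simp: r_def)
    then have "(of_nat (k * (r choose 2)) :: 'a) = (if even (m * k) then 0 else 1)"
      by (simp only: of_nat_eq_if_even)
    moreover have "1 \<le> q ^ (2 * m)"
      using q_gt_1 by simp
    then have "int (q ^ (2 * m) - 1) = int q ^ (2 * m) - 1"
      by (simp only: of_nat_diff of_nat_power of_nat_1)
    \<comment> \<open>The count \<open>q ^ (2 * m) * (q ^ (2 * m) - 1 + j)\<close> with
      \<open>j\<close> equal to \<open>2\<close> or \<open>0\<close> is \<open>q ^ (4 * m)\<close>
      plus or minus \<open>q ^ (2 * m)\<close>. The plus sign occurs when the character is
      \<open>- ((- 1) ^ (m * k))\<close>.\<close>
    ultimately show ?thesis
      using False unfolding n(1) count_trace_nonzero[OF assms(7,8) False] n(2,3) power_add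
      by (auto simp: canonical_char_def algebra_simps)
  qed
qed

end
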